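(* Let $G$ and $H$ be finite non-nilpotent groups. Then $\Gamma_{\mathfrak N}(G\times H)$ is connected.
   Context: For a finite group $G$, $\mathrm{nil}(G)=\{g\in G:\langle g,h\rangle \text{ is nilpotent for all } h\in G\}$. For a finite non-nilpotent group $G$, the nilpotent graph $\Gamma_{\mathfrak N}(G)$ is the simple undirected graph with vertex set $G-\mathrm{nil}(G)$ (set difference) in which two distinct vertices $g,h$ are adjacent if and only if $\langle g,h\rangle$ is nilpotent. *)

theory Defs
  imports "HOL-Algebra.Generated_Groups" "Graph_Theory.Digraph_Component"
begin

text \<open>
  The upper central series \<open>Z\<^sub>0 = 1\<close> and \<open>Z\<^sub>n\<^sub>+\<^sub>1 / Z\<^sub>n = Z(G / Z\<^sub>n)\<close>; the latter
  says that \<open>x \<in> Z\<^sub>n\<^sub>+\<^sub>1\<close> iff all commutators of \<open>x\<close> with elements of \<open>G\<close> lie in \<open>Z\<^sub>n\<close>.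
\<close>

primrec upper_central :: "('a, 'b) monoid_scheme \<Rightarrow> nat \<Rightarrow> 'a set" where
  "upper_central G 0 = {\<one>\<^bsub>G\<^esub>}"
| "upper_central G (Suc n) =
     {x \<in> carrier G. \<forall>y \<in> carrier G.
        x \<otimes>\<^bsub>G\<^esub> y \<otimes>\<^bsub>G\<^esub> inv\<^bsub>G\<^esub> x \<otimes>\<^bsub>G\<^esub> inv\<^bsub>G\<^esub> y \<in> upper_central G n}"

definition nilpotent :: "('a, 'b) monoid_scheme \<Rightarrow> bool" where
  "nilpotent G \<longleftrightarrow> (\<exists>n. upper_central G n = carrier G)"

definition generates_nilpotent :: "('a, 'b) monoid_scheme \<Rightarrow> 'a \<Rightarrow> 'a \<Rightarrow> bool" where
  "generates_nilpotent G g h \<longleftrightarrow> nilpotent (G\<lparr>carrier := generate G {g, h}\<rparr>)"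

definition nil :: "('a, 'b) monoid_scheme \<Rightarrow> 'a set" where
  "nil G = {g \<in> carrier G. \<forall>h \<in> carrier G. generates_nilpotent G g h}"

text \<open>
  The nilpotent graph. A simple undirected graph is represented, as usual in \<open>Graph_Theory\<close>,
  by a loop-free digraph without parallel arcs that contains both orientations of each edge.
\<close>

definition nilpotent_graph :: "('a, 'b) monoid_scheme \<Rightarrow> 'a pair_pre_digraph" where
  "nilpotent_graph G =
     \<lparr> pverts = carrier G - nil G,
       parcs = {(g, h). g \<in> carrier G - nil G \<and> h \<in> carrier G - nil G \<and> g \<noteq> h \<and>
                        generates_nilpotent G g h} \<rparr>"

lemma pair_graph_nilpotent_graph:
  assumes "finite (carrier G)"
  shows "pair_graph (nilpotent_graph G)"
proof -
  let ?V = "carrier G - nil G"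
  have "parcs (nilpotent_graph G) \<subseteq> ?V \<times> ?V"
    by (auto simp: nilpotent_graph_def)
  then have "finite (parcs (nilpotent_graph G))"
    using assms by (auto intro: finite_subset)
  moreover have "generates_nilpotent G g h = generates_nilpotent G h g" for g h
    by (simp add: generates_nilpotent_def insert_commute)
  ultimately show ?thesis
    using assms
    by unfold_locales (auto simp: nilpotent_graph_def symmetric_def sym_def)
qed

end

theory Submission
  imports Defs "HOL-Algebra.Sylow" "HOL-Algebra.Group_Action" "HOL-Algebra.Multiplicative_Group"
begin

text \<open>
  The elements \<open>(g, 1)\<close> and \<open>(1, h)\<close> of \<open>G \<times> H\<close> commute, so they generate an abelian, hence
  nilpotent, subgroup. Likewise \<open>(g, h)\<close> commutes with both \<open>(g, 1)\<close> and \<open>(1, h)\<close>. Moreover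
  \<open>nil (G \<times> H) = nil G \<times> nil H\<close>, because \<open>\<langle>(g, h), (g', h')\<rangle>\<close> is a subgroup of
  \<open>\<langle>g, g'\<rangle> \<times> \<langle>h, h'\<rangle>\<close> that projects onto both factors. A vertex \<open>(g, h)\<close> therefore has a coordinate
  outside \<open>nil\<close> of its factor and reaches \<open>(g, 1)\<close> or \<open>(1, h)\<close> through vertices only, and these
  two kinds of vertices are all joined to each other. Both kinds occur: that is the point at which
  the factors being non-nilpotent is needed, and it is the substance of the proof.

  What has to be shown is that a finite group \<open>G\<close> all of whose two-generated subgroups are
  nilpotent is itself nilpotent. In a nilpotent group, elements of coprime orders commute
  (\<open>nilpotent_coprime_commute\<close>). Hence in \<open>G\<close> a nontrivial central element of a Sylow \<open>p\<close>-subgroup commutes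
  with that subgroup and with every Sylow \<open>q\<close>-subgroup for \<open>q \<noteq> p\<close>; its centralizer has order
  divisible by \<open>|G|\<close>, so it is central in \<open>G\<close>
  (\<open>central_element_if_all_pairs_nilpotent\<close>). The hypothesis passes to quotients, so the upper central
  series cannot stop below \<open>G\<close> (\<open>nilpotent_if_all_pairs_nilpotent\<close>).
\<close>

section \<open>The upper central series\<close>

lemma (in group) commutator_eq_one_iff:
  assumes "x \<in> carrier G" "y \<in> carrier G"
  shows "x \<otimes> y \<otimes> inv x \<otimes> inv y = \<one> \<longleftrightarrow> x \<otimes> y = y \<otimes> x"
proof -
  have "x \<otimes> y \<otimes> inv x \<otimes> inv y = (x \<otimes> y) \<otimes> inv (y \<otimes> x)"
    using assms by (simp add: inv_mult_group m_assoc)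
  then show ?thesis
    using assms inv_solve_right[of \<one> "x \<otimes> y" "y \<otimes> x"] by (simp add: eq_commute[of \<one>])
qed

lemma (in group_hom) hom_commutator:
  assumes "x \<in> carrier G" "y \<in> carrier G"
  shows "h (x \<otimes>\<^bsub>G\<^esub> y \<otimes>\<^bsub>G\<^esub> inv\<^bsub>G\<^esub> x \<otimes>\<^bsub>G\<^esub> inv\<^bsub>G\<^esub> y)
    = h x \<otimes>\<^bsub>H\<^esub> h y \<otimes>\<^bsub>H\<^esub> inv\<^bsub>H\<^esub> h x \<otimes>\<^bsub>H\<^esub> inv\<^bsub>H\<^esub> h y"
  using assms by simp

lemma (in normal) coset_map_group_hom: "group_hom G (G Mod H) (\<lambda>a. H #> a)"
  by (simp add: group_hom.intro group_hom_axioms.intro factorgroup_is_group r_coset_hom_Mod is_group)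

lemma (in normal) coset_eq_one_iff:
  assumes "x \<in> carrier G"
  shows "H #> x = \<one>\<^bsub>G Mod H\<^esub> \<longleftrightarrow> x \<in> H"
  using coset_join1[OF _ assms subgroup_axioms] coset_join2[OF assms subgroup_axioms]
  by auto

text \<open>
  With \<open>H = Z\<^sub>n\<close> this turns the commutator condition that defines \<open>Z\<^sub>n\<^sub>+\<^sub>1\<close> into centrality in \<open>G / Z\<^sub>n\<close>.
\<close>

lemma (in normal) commutator_mem_iff:
  assumes "x \<in> carrier G" "y \<in> carrier G"
  shows "x \<otimes> y \<otimes> inv x \<otimes> inv y \<in> H \<longleftrightarrow>
    (H #> x) \<otimes>\<^bsub>G Mod H\<^esub> (H #> y) = (H #> y) \<otimes>\<^bsub>G Mod H\<^esub> (H #> x)"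
proof -
  interpret q: group_hom G "G Mod H" "\<lambda>a. H #> a" by (rule coset_map_group_hom)
  have "x \<otimes> y \<otimes> inv x \<otimes> inv y \<in> H \<longleftrightarrow> H #> (x \<otimes> y \<otimes> inv x \<otimes> inv y) = \<one>\<^bsub>G Mod H\<^esub>"
    using assms by (intro coset_eq_one_iff[symmetric]) simp
  also have "\<dots> \<longleftrightarrow> (H #> x) \<otimes>\<^bsub>G Mod H\<^esub> (H #> y) = (H #> y) \<otimes>\<^bsub>G Mod H\<^esub> (H #> x)"
    unfolding q.hom_commutator[OF assms]
    by (rule q.H.commutator_eq_one_iff) (use assms in auto)
  finally show ?thesis .
qed

lemma (in group) inv_commute:
  assumes "a \<in> carrier G" "b \<in> carrier G" "a \<otimes> b = b \<otimes> a"
  shows "inv a \<otimes> b = b \<otimes> inv a"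
proof -
  have "b = inv a \<otimes> (b \<otimes> a)"
    using assms by (simp add: inv_solve_left)
  then have "b = (inv a \<otimes> b) \<otimes> a"
    using assms by (simp add: m_assoc)
  then show ?thesis using assms inv_solve_right[of "inv a \<otimes> b" b a] by simp
qed

lemma (in group_hom) central_preimage_normal:
  "{x \<in> carrier G. \<forall>y\<in>carrier G. h x \<otimes>\<^bsub>H\<^esub> h y = h y \<otimes>\<^bsub>H\<^esub> h x} \<lhd> G" (is "?C \<lhd> G")
  unfolding G.normal_inv_iff
proof (intro conjI ballI)
  show "subgroup ?C G"
  proof (rule subgroup.intro)
    show "?C \<subseteq> carrier G" by blast
  next
    fix x x' assume x: "x \<in> ?C" and x': "x' \<in> ?C"
    then have c: "x \<in> carrier G" "x' \<in> carrier G" by blast+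
    have "h (x \<otimes> x') \<otimes>\<^bsub>H\<^esub> h y = h y \<otimes>\<^bsub>H\<^esub> h (x \<otimes> x')" if y: "y \<in> carrier G" for y
    proof -
      have e: "h x \<otimes>\<^bsub>H\<^esub> h y = h y \<otimes>\<^bsub>H\<^esub> h x" "h x' \<otimes>\<^bsub>H\<^esub> h y = h y \<otimes>\<^bsub>H\<^esub> h x'"
        using x x' y by blast+
      have "h (x \<otimes> x') \<otimes>\<^bsub>H\<^esub> h y = h x \<otimes>\<^bsub>H\<^esub> (h x' \<otimes>\<^bsub>H\<^esub> h y)"
        using c y by (simp add: H.m_assoc)
      also have "\<dots> = (h x \<otimes>\<^bsub>H\<^esub> h y) \<otimes>\<^bsub>H\<^esub> h x'"
        unfolding e(2) using c y by (simp add: H.m_assoc)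
      also have "\<dots> = h y \<otimes>\<^bsub>H\<^esub> h (x \<otimes> x')"
        unfolding e(1) using c y by (simp add: H.m_assoc)
      finally show ?thesis .
    qed
    then show "x \<otimes> x' \<in> ?C" using c by blast
  next
    show "\<one> \<in> ?C" by simp
  next
    fix x assume x: "x \<in> ?C"
    then have c: "x \<in> carrier G" by blast
    have "h (inv x) \<otimes>\<^bsub>H\<^esub> h y = h y \<otimes>\<^bsub>H\<^esub> h (inv x)" if y: "y \<in> carrier G" for y
      unfolding hom_inv[OF c]
      using hom_closed[OF c] hom_closed[OF y] x y by (intro H.inv_commute) blast+
    then show "inv x \<in> ?C" using c by blast
  qed
next
  fix y x assume y: "y \<in> carrier G" and x: "x \<in> ?C"
  then have c: "x \<in> carrier G" and e: "h x \<otimes>\<^bsub>H\<^esub> h y = h y \<otimes>\<^bsub>H\<^esub> h x" by blast+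
  have "h (y \<otimes> x \<otimes> inv y) = h y \<otimes>\<^bsub>H\<^esub> h x \<otimes>\<^bsub>H\<^esub> inv\<^bsub>H\<^esub> h y"
    using c y by simp
  also have "\<dots> = h x"
    unfolding e[symmetric] using c y by (simp add: H.m_assoc)
  finally have same: "h (y \<otimes> x \<otimes> inv y) = h x" .
  have "\<forall>z\<in>carrier G. h x \<otimes>\<^bsub>H\<^esub> h z = h z \<otimes>\<^bsub>H\<^esub> h x" using x by blast
  then have "\<forall>z\<in>carrier G. h (y \<otimes> x \<otimes> inv y) \<otimes>\<^bsub>H\<^esub> h z = h z \<otimes>\<^bsub>H\<^esub> h (y \<otimes> x \<otimes> inv y)"
    unfolding same .
  moreover have "y \<otimes> x \<otimes> inv y \<in> carrier G" using c y by simp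
  ultimately show "y \<otimes> x \<otimes> inv y \<in> ?C" by blast
qed

text \<open>\<open>Z\<^sub>n\<^sub>+\<^sub>1\<close> is the preimage of the centre of \<open>G / Z\<^sub>n\<close>.\<close>

lemma (in group) upper_central_normal: "upper_central G n \<lhd> G"
proof (induction n)
  case 0
  then show ?case by (simp add: one_is_normal)
next
  case (Suc n)
  let ?Z = "upper_central G n"
  interpret N: normal ?Z G by (rule Suc)
  interpret q: group_hom G "G Mod ?Z" "\<lambda>a. ?Z #> a" by (rule N.coset_map_group_hom)
  have "upper_central G (Suc n) = {x \<in> carrier G. \<forall>y\<in>carrier G.
      (?Z #> x) \<otimes>\<^bsub>G Mod ?Z\<^esub> (?Z #> y) = (?Z #> y) \<otimes>\<^bsub>G Mod ?Z\<^esub> (?Z #> x)}"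
    using N.commutator_mem_iff by (auto simp del: mult_FactGroup)
  then show ?case using q.central_preimage_normal by (simp only:)
qed

lemma (in group) upper_central_subset: "upper_central G n \<subseteq> carrier G"
  using upper_central_normal normal_imp_subgroup subgroup.subset by blast

lemma (in group) upper_central_Suc_iff:
  assumes "x \<in> carrier G"
  shows "x \<in> upper_central G (Suc n) \<longleftrightarrow> (\<forall>Y\<in>carrier (G Mod upper_central G n).
    (upper_central G n #> x) \<otimes>\<^bsub>G Mod upper_central G n\<^esub> Y
      = Y \<otimes>\<^bsub>G Mod upper_central G n\<^esub> (upper_central G n #> x))"
proof -
  interpret N: normal "upper_central G n" G by (rule upper_central_normal)
  have "x \<in> upper_central G (Suc n) \<longleftrightarrow>
      (\<forall>y\<in>carrier G. x \<otimes> y \<otimes> inv x \<otimes> inv y \<in> upper_central G n)"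
    using assms by simp
  then show ?thesis
    unfolding carrier_FactGroup by (simp only: N.commutator_mem_iff[OF assms] ball_simps cong: ball_cong)
qed

lemma (in group) upper_central_incr: "upper_central G n \<subseteq> upper_central G (Suc n)"
proof
  interpret N: normal "upper_central G n" G by (rule upper_central_normal)
  interpret q: group_hom G "G Mod upper_central G n" "\<lambda>a. upper_central G n #> a"
    by (rule N.coset_map_group_hom)
  fix x assume x: "x \<in> upper_central G n"
  then have xG: "x \<in> carrier G" using upper_central_subset by blast
  have "upper_central G n #> x = \<one>\<^bsub>G Mod upper_central G n\<^esub>"
    using x xG N.coset_eq_one_iff by blast
  then show "x \<in> upper_central G (Suc n)"
    unfolding upper_central_Suc_iff[OF xG]
    by (metis q.H.l_one q.H.r_one)
qed

lemma (in group) upper_central_mono: "m \<le> n \<Longrightarrow> upper_central G m \<subseteq> upper_central G n"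
  by (rule lift_Suc_mono_le[of "upper_central G", OF upper_central_incr])

section \<open>Closure properties of nilpotency\<close>

lemma (in group_hom) nilpotent_image:
  assumes "h ` carrier G = carrier H" "nilpotent G"
  shows "nilpotent H"
proof -
  have step: "h x \<in> upper_central H n" if "x \<in> upper_central G n" for x n
    using that
  proof (induction n arbitrary: x)
    case 0
    then show ?case by simp
  next
    case (Suc n)
    then have x: "x \<in> carrier G" by simp
    have "h x \<otimes>\<^bsub>H\<^esub> h y \<otimes>\<^bsub>H\<^esub> inv\<^bsub>H\<^esub> h x \<otimes>\<^bsub>H\<^esub> inv\<^bsub>H\<^esub> h y \<in> upper_central H n"
      if "y \<in> carrier G" for y
      using Suc that hom_commutator[OF x that] by (metis (no_types, lifting) mem_Collect_eq upper_central.simps(2))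
    then show ?case using x by (auto simp flip: assms(1))
  qed
  obtain n where n: "upper_central G n = carrier G"
    using assms(2) unfolding nilpotent_def by blast
  have "h x \<in> upper_central H n" if "x \<in> carrier G" for x
    using step[of x n] that n by simp
  then have "carrier H \<subseteq> upper_central H n"
    unfolding assms(1)[symmetric] by (rule image_subsetI)
  then show ?thesis unfolding nilpotent_def using H.upper_central_subset[of n] by (intro exI[of _ n]) (rule subset_antisym)
qed

text \<open>
  Two homomorphisms with trivially intersecting kernels embed \<open>K\<close> into \<open>A \<times> B\<close>. Stating closure
  under products and subgroups in this combined form means that the upper central series of a
  product or of a subgroup never has to be computed.
\<close>

lemma nilpotent_jointly_injective:
  assumes "group_hom K A f" "group_hom K B g" "nilpotent A" "nilpotent B"
    and inj: "\<And>x. x \<in> carrier K \<Longrightarrow> f x = \<one>\<^bsub>A\<^esub> \<Longrightarrow> g x = \<one>\<^bsub>B\<^esub> \<Longrightarrow> x = \<one>\<^bsub>K\<^esub>"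
  shows "nilpotent K"
proof -
  interpret f: group_hom K A f by fact
  interpret g: group_hom K B g by fact
  have *: "x \<in> upper_central K n"
    if "x \<in> carrier K" "f x \<in> upper_central A n" "g x \<in> upper_central B n" for x n
    using that
  proof (induction n arbitrary: x)
    case 0
    then show ?case using inj by simp
  next
    case (Suc n)
    have "x \<otimes>\<^bsub>K\<^esub> y \<otimes>\<^bsub>K\<^esub> inv\<^bsub>K\<^esub> x \<otimes>\<^bsub>K\<^esub> inv\<^bsub>K\<^esub> y \<in> upper_central K n" if y: "y \<in> carrier K" for y
      using Suc.prems y
      by (intro Suc.IH; (unfold f.hom_commutator[OF Suc.prems(1) y] g.hom_commutator[OF Suc.prems(1) y])?) auto
    then show ?case using Suc.prems(1) by simp
  qed
  obtain m n where "upper_central A m = carrier A" "upper_central B n = carrier B"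
    using assms(3,4) unfolding nilpotent_def by blast
  then have "carrier A \<subseteq> upper_central A (max m n)" "carrier B \<subseteq> upper_central B (max m n)"
    using f.H.upper_central_mono[of m "max m n"] g.H.upper_central_mono[of n "max m n"] by auto
  then have "carrier K \<subseteq> upper_central K (max m n)"
    using f.hom_closed g.hom_closed by (intro subsetI *) (assumption, (erule subsetD, blast)+)
  then show ?thesis
    unfolding nilpotent_def using f.G.upper_central_subset[of "max m n"] by (intro exI[of _ "max m n"]) (rule subset_antisym)
qed

lemma (in group) centralizer_subgroup:
  assumes "S \<subseteq> carrier G"
  shows "subgroup {z \<in> carrier G. \<forall>s\<in>S. z \<otimes> s = s \<otimes> z} G" (is "subgroup ?C G")
proof (rule subgroup.intro)
  show "?C \<subseteq> carrier G" by blast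
next
  fix x y assume x: "x \<in> ?C" and y: "y \<in> ?C"
  then have c: "x \<in> carrier G" "y \<in> carrier G" by blast+
  have "(x \<otimes> y) \<otimes> s = s \<otimes> (x \<otimes> y)" if s: "s \<in> S" for s
  proof -
    have e: "x \<otimes> s = s \<otimes> x" "y \<otimes> s = s \<otimes> y" and sG: "s \<in> carrier G"
      using x y s assms by blast+
    have "(x \<otimes> y) \<otimes> s = (x \<otimes> s) \<otimes> y" using c sG e(2) by (simp add: m_assoc)
    also have "\<dots> = s \<otimes> (x \<otimes> y)" unfolding e(1) using c sG by (simp add: m_assoc)
    finally show ?thesis .
  qed
  then show "x \<otimes> y \<in> ?C" using c by blast
next
  show "\<one> \<in> ?C" using assms by auto
next
  fix x assume x: "x \<in> ?C"
  then have c: "x \<in> carrier G" by blast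
  have "inv x \<otimes> s = s \<otimes> inv x" if "s \<in> S" for s
    using x that assms by (intro inv_commute) blast+
  then show "inv x \<in> ?C" using c by blast
qed

text \<open>
  Commuting of the generators spreads to \<open>K = \<langle>x, y\<rangle>\<close> in two steps: \<open>K\<close> lies in the centralizer of
  \<open>{x, y}\<close>, so \<open>{x, y}\<close>, and with it \<open>K\<close>, lies in the centralizer of \<open>K\<close>.
\<close>

lemma (in group) generates_nilpotent_if_commute:
  assumes "x \<in> carrier G" "y \<in> carrier G" "x \<otimes> y = y \<otimes> x"
  shows "generates_nilpotent G x y"
proof -
  let ?K = "generate G {x, y}"
  have sub: "subgroup ?K G" using assms by (intro generate_is_subgroup) auto
  then have KG: "?K \<subseteq> carrier G" by (rule subgroup.subset)
  interpret K: group "G\<lparr>carrier := ?K\<rparr>" using sub by (rule subgroup_imp_group)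
  have "?K \<subseteq> {z \<in> carrier G. \<forall>s\<in>{x, y}. z \<otimes> s = s \<otimes> z}"
    using assms by (intro generate_subgroup_incl centralizer_subgroup) auto
  then have "{x, y} \<subseteq> {z \<in> carrier G. \<forall>s\<in>?K. z \<otimes> s = s \<otimes> z}"
    using assms by (auto dest: subsetD)
  then have "?K \<subseteq> {z \<in> carrier G. \<forall>s\<in>?K. z \<otimes> s = s \<otimes> z}"
    by (intro generate_subgroup_incl centralizer_subgroup KG)
  then have comm: "z \<otimes> s = s \<otimes> z" if "z \<in> ?K" "s \<in> ?K" for z s using that by blast
  have "upper_central (G\<lparr>carrier := ?K\<rparr>) 1 = carrier (G\<lparr>carrier := ?K\<rparr>)"
    using K.commutator_eq_one_iff comm by auto
  then show ?thesis unfolding generates_nilpotent_def nilpotent_def by blast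
qed

lemma (in group_hom) group_hom_generate:
  assumes "S \<subseteq> carrier G"
  shows "group_hom (G\<lparr>carrier := generate G S\<rparr>) (H\<lparr>carrier := generate H (h ` S)\<rparr>) h"
proof -
  have K: "subgroup (generate G S) G" and L: "subgroup (generate H (h ` S)) H"
    using assms by (auto intro!: G.generate_is_subgroup H.generate_is_subgroup)
  then show ?thesis
    using generate_img[OF assms, symmetric]
    by (intro group_hom.intro group_hom_axioms.intro G.subgroup_imp_group H.subgroup_imp_group)
       (auto simp: hom_def subgroup.mem_carrier[OF K])
qed

lemma (in group_hom) generates_nilpotent_image:
  assumes "x \<in> carrier G" "y \<in> carrier G" "generates_nilpotent G x y"
  shows "generates_nilpotent H (h x) (h y)"
proof -
  have "h ` generate G {x, y} = generate H {h x, h y}"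
    using generate_img[of "{x,y}"] assms by simp
  then show ?thesis
    using assms group_hom.nilpotent_image[OF group_hom_generate[of "{x,y}"]]
    by (simp add: generates_nilpotent_def)
qed

lemma generates_nilpotent_DirProd:
  assumes "group G" "group H" "g \<in> carrier G" "g' \<in> carrier G" "h \<in> carrier H" "h' \<in> carrier H"
  shows "generates_nilpotent (G \<times>\<times> H) (g, h) (g', h')
    \<longleftrightarrow> generates_nilpotent G g g' \<and> generates_nilpotent H h h'" (is "?L \<longleftrightarrow> ?R")
proof
  interpret G: group G by fact
  interpret H: group H by fact
  interpret P: group "G \<times>\<times> H" by (rule DirProd_group[OF assms(1,2)])
  interpret fst: group_hom "G \<times>\<times> H" G fst
    by unfold_locales (auto simp: hom_def)
  interpret snd: group_hom "G \<times>\<times> H" H snd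
    by unfold_locales (auto simp: hom_def)
  show ?R if ?L
    using fst.generates_nilpotent_image[OF _ _ that] snd.generates_nilpotent_image[OF _ _ that] assms
    by simp
  let ?S = "{(g, h), (g', h')}"
  have S: "?S \<subseteq> carrier (G \<times>\<times> H)" using assms by auto
  have "nilpotent ((G \<times>\<times> H)\<lparr>carrier := generate (G \<times>\<times> H) ?S\<rparr>)" if ?R
    using that
    by (intro nilpotent_jointly_injective[OF fst.group_hom_generate[OF S] snd.group_hom_generate[OF S]])
       (auto simp: generates_nilpotent_def)
  then show ?L if ?R using that by (simp add: generates_nilpotent_def)
qed

section \<open>Elements of coprime order\<close>

lemma (in group) pow_commutator_central:
  assumes "x \<in> carrier G" "y \<in> carrier G" "c \<in> carrier G"
    and "c \<otimes> x = x \<otimes> c" "x \<otimes> y = c \<otimes> (y \<otimes> x)"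
  shows "x [^] (k::nat) \<otimes> y = c [^] k \<otimes> (y \<otimes> x [^] k)"
proof (induction k)
  case 0
  then show ?case using assms by simp
next
  case (Suc k)
  have xc: "x \<otimes> c [^] k = c [^] k \<otimes> x"
    using assms(1,3,4) by (simp add: group_commutes_pow)
  have "x [^] Suc k \<otimes> y = x \<otimes> (x [^] k \<otimes> y)"
    unfolding nat_pow_Suc2[OF assms(1)] using assms(1,2) by (simp add: m_assoc)
  also have "\<dots> = (x \<otimes> c [^] k) \<otimes> (y \<otimes> x [^] k)"
    unfolding Suc using assms(1-3) by (simp add: m_assoc)
  also have "\<dots> = c [^] k \<otimes> (x \<otimes> y) \<otimes> x [^] k"
    unfolding xc using assms(1-3) by (simp add: m_assoc)
  also have "\<dots> = c [^] Suc k \<otimes> (y \<otimes> (x \<otimes> x [^] k))"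
    unfolding assms(5) using assms(1-3) by (simp add: m_assoc)
  also have "x \<otimes> x [^] k = x [^] Suc k"
    by (rule nat_pow_Suc2[OF assms(1), symmetric])
  finally show ?case .
qed

text \<open>
  For a commutator \<open>c = [x, y]\<close> that commutes with \<open>x\<close> and \<open>y\<close> one has \<open>[x\<^sup>k, y] = c\<^sup>k = [x, y\<^sup>k]\<close>,
  so the order of \<open>c\<close> divides the coprime exponents \<open>a\<close> and \<open>b\<close>.
\<close>

lemma (in group) coprime_commutator_central:
  assumes "x \<in> carrier G" "y \<in> carrier G" "c \<in> carrier G"
    and "c \<otimes> x = x \<otimes> c" "c \<otimes> y = y \<otimes> c" "x \<otimes> y = c \<otimes> (y \<otimes> x)"
    and "x [^] (a::nat) = \<one>" "y [^] (b::nat) = \<one>" "coprime a b"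
  shows "c = \<one>"
proof -
  have "y = c [^] a \<otimes> y"
    using pow_commutator_central[OF assms(1-4,6), of a] assms(1-3,7) by simp
  then have a: "c [^] a = \<one>"
    using assms(2,3) by simp
  \<comment> \<open>Exchanging \<open>x\<close> and \<open>y\<close> turns the commutator into its inverse.\<close>
  have "y \<otimes> x = inv c \<otimes> (x \<otimes> y)"
    unfolding assms(6) using assms(1-3) by (simp flip: m_assoc)
  then have "y [^] b \<otimes> x = inv c [^] b \<otimes> (x \<otimes> y [^] b)"
    using assms(1-3) inv_commute[OF assms(3,2,5)] by (intro pow_commutator_central) simp_all
  then have "x = inv c [^] b \<otimes> x"
    using assms(1-3,8) by simp
  then have "inv c [^] b = \<one>"
    using assms(1,3) by simp
  then have b: "c [^] b = \<one>"
    using assms(3) by (simp add: nat_pow_inv)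
  have "ord c dvd a" "ord c dvd b" using a b assms(3) pow_eq_id by auto
  then have "ord c = 1" using assms(9) by (metis coprime_common_divisor_nat)
  then show ?thesis using assms(3) ord_eq_1 by blast
qed

text \<open>
  The commutator of \<open>x\<close> and \<open>y\<close> descends the upper central series: if it lies in \<open>Z\<^sub>n\<^sub>+\<^sub>1\<close>, its image in
  \<open>G / Z\<^sub>n\<close> is central, hence trivial by coprimality, so it lies in \<open>Z\<^sub>n\<close>.
\<close>

lemma (in group) nilpotent_coprime_commute:
  assumes "nilpotent G" "x \<in> carrier G" "y \<in> carrier G"
    and "x [^] (a::nat) = \<one>" "y [^] (b::nat) = \<one>" "coprime a b"
  shows "x \<otimes> y = y \<otimes> x"
proof -
  let ?c = "x \<otimes> y \<otimes> inv x \<otimes> inv y"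
  have c: "?c \<in> carrier G" using assms by simp
  have desc: "?c \<in> upper_central G n" if "?c \<in> upper_central G (Suc n)" for n
  proof -
    let ?Z = "upper_central G n"
    interpret N: normal ?Z G by (rule upper_central_normal)
    interpret q: group_hom G "G Mod ?Z" "\<lambda>a. ?Z #> a" by (rule N.coset_map_group_hom)
    have central: "(?Z #> ?c) \<otimes>\<^bsub>G Mod ?Z\<^esub> (?Z #> z) = (?Z #> z) \<otimes>\<^bsub>G Mod ?Z\<^esub> (?Z #> ?c)"
      if "z \<in> carrier G" for z
      using \<open>?c \<in> upper_central G (Suc n)\<close> that q.hom_closed
      unfolding upper_central_Suc_iff[OF c] by blast
    have "x \<otimes> y = ?c \<otimes> (y \<otimes> x)"
    proof -
      have "?c \<otimes> (y \<otimes> x) = x \<otimes> y \<otimes> (inv (y \<otimes> x) \<otimes> (y \<otimes> x))"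
        using assms(2,3) unfolding inv_mult_group[OF assms(3,2)] by (simp only: m_assoc inv_closed m_closed)
      also have "\<dots> = x \<otimes> y" using assms(2,3) by (simp only: l_inv m_closed r_one)
      finally show ?thesis ..
    qed
    then have "?Z #> (x \<otimes> y) = ?Z #> (?c \<otimes> (y \<otimes> x))" by simp
    then have comm: "(?Z #> x) \<otimes>\<^bsub>G Mod ?Z\<^esub> (?Z #> y)
        = (?Z #> ?c) \<otimes>\<^bsub>G Mod ?Z\<^esub> ((?Z #> y) \<otimes>\<^bsub>G Mod ?Z\<^esub> (?Z #> x))"
      using q.hom_mult assms c m_closed by metis
    have pow: "(?Z #> x) [^]\<^bsub>G Mod ?Z\<^esub> a = \<one>\<^bsub>G Mod ?Z\<^esub>" "(?Z #> y) [^]\<^bsub>G Mod ?Z\<^esub> b = \<one>\<^bsub>G Mod ?Z\<^esub>"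
      using q.hom_nat_pow assms q.hom_one by metis+
    have "?Z #> ?c = \<one>\<^bsub>G Mod ?Z\<^esub>"
      by (rule q.H.coprime_commutator_central[OF q.hom_closed[OF assms(2)] q.hom_closed[OF assms(3)]
            q.hom_closed[OF c] central[OF assms(2)] central[OF assms(3)] comm pow assms(6)])
    then show ?thesis using N.coset_eq_one_iff c by blast
  qed
  obtain n where "upper_central G n = carrier G"
    using assms(1) unfolding nilpotent_def by blast
  then have "?c \<in> upper_central G n" using c by simp
  then have "?c \<in> upper_central G 0" by (induction n) (use desc in blast)+
  then show ?thesis using assms commutator_eq_one_iff by simp
qed

section \<open>Nilpotency from two-generated subgroups\<close>

text \<open>
  The class equation: conjugacy classes have \<open>p\<close>-power size, and a class of size 1 is a central
  element. If \<open>{1}\<close> were the only such class, the order of the group would be 1 modulo \<open>p\<close>.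
\<close>

lemma (in group) p_group_central_element:
  assumes "prime p" "order G = p ^ n" "n > 0"
  shows "\<exists>z\<in>carrier G. z \<noteq> \<one> \<and> (\<forall>x\<in>carrier G. z \<otimes> x = x \<otimes> z)"
proof (rule ccontr)
  assume no: "\<not> ?thesis"
  let ?phi = "\<lambda>g. \<lambda>x\<in>carrier G. g \<otimes> x \<otimes> inv g"
  interpret act: group_action G "carrier G" ?phi by (rule action_by_conjugation)
  let ?O = "orbits G (carrier G) ?phi"
  have fin: "finite (carrier G)"
    using assms by (metis card.infinite order_def power_not_zero prime_gt_0_nat less_numeral_extra(3))
  have finO: "finite ?O" unfolding orbits_def using fin by simp
  have one: "orbit G ?phi \<one> = {\<one>}"
    unfolding orbit_def by (auto intro!: exI[of _ \<one>])
  have div: "p dvd card B" if B: "B \<in> ?O" "B \<noteq> {\<one>}" for B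
  proof (rule ccontr)
    assume np: "\<not> p dvd card B"
    obtain z where z: "z \<in> carrier G" "B = orbit G ?phi z"
      using B(1) unfolding orbits_def by blast
    have "card B dvd p ^ n"
      unfolding z(2) assms(2)[symmetric] act.orbit_stabilizer_theorem[OF z(1), symmetric]
      by (rule dvd_triv_left)
    then obtain k where "card B = p ^ k"
      using divides_primepow_nat[OF assms(1)] by blast
    then have "card B = 1" using np by (cases k) auto
    then have Bz: "B = {z}"
      using act.orbit_refl[OF z(1)] unfolding z(2)[symmetric] by (elim card_1_singletonE) auto
    have "z \<otimes> x = x \<otimes> z" if x: "x \<in> carrier G" for x
    proof -
      have "x \<otimes> z \<otimes> inv x \<in> B"
        unfolding z(2) orbit_def using x z(1) by force
      then have "z = x \<otimes> z \<otimes> inv x" using Bz by (metis singletonD)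
      then show ?thesis using x z(1) inv_solve_right[of z "x \<otimes> z" x] by simp
    qed
    then have "z = \<one>" using no z(1) by blast
    then show False using B(2) Bz by blast
  qed
  have "\<one> \<in> carrier G" by simp
  then have oneO: "{\<one>} \<in> ?O" unfolding orbits_def using one by force
  have "p ^ n = (\<Sum>B\<in>?O. card B)"
    using act.disjoint_sum[OF fin, of "\<lambda>_. 1::nat"] assms(2) by (simp add: order_def)
  also have "\<dots> = 1 + (\<Sum>B\<in>?O - {{\<one>}}. card B)"
    using finO oneO by (simp add: sum.remove)
  finally have "p ^ n = 1 + (\<Sum>B\<in>?O - {{\<one>}}. card B)" .
  then have "p dvd 1 + (\<Sum>B\<in>?O - {{\<one>}}. card B)"
    using assms(3) by (intro dvd_trans[OF dvd_power[of n p]]) auto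
  moreover have "p dvd (\<Sum>B\<in>?O - {{\<one>}}. card B)"
    by (rule dvd_sum) (rule div; blast)
  ultimately have "p dvd 1" by (simp only: dvd_add_left_iff)
  then show False using assms(1) by (simp add: prime_nat_iff)
qed

lemma (in group) subgroup_card_dvd:
  assumes "subgroup S G" "subgroup C G" "S \<subseteq> C"
  shows "card S dvd card C"
proof -
  interpret C: group "G\<lparr>carrier := C\<rparr>" using assms(2) by (rule subgroup_imp_group)
  have "subgroup S (G\<lparr>carrier := C\<rparr>)" using assms by (rule subgroup_incl)
  from C.lagrange[OF this] show ?thesis by (simp add: order_def) (metis dvd_triv_right)
qed

text \<open>
  The witness is a nontrivial central element \<open>z\<close> of a Sylow \<open>p\<close>-subgroup \<open>P\<close>. Its centralizer contains
  a Sylow subgroup for every prime: \<open>P\<close> for \<open>p\<close> itself, and any Sylow \<open>q\<close>-subgroup for \<open>q \<noteq> p\<close> because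
  its elements have order coprime to that of \<open>z\<close>.
\<close>

lemma (in group) central_element_if_all_pairs_nilpotent:
  assumes fin: "finite (carrier G)" and nontriv: "carrier G \<noteq> {\<one>}"
    and pairs: "\<And>x y. x \<in> carrier G \<Longrightarrow> y \<in> carrier G \<Longrightarrow> generates_nilpotent G x y"
  shows "\<exists>z\<in>carrier G. z \<noteq> \<one> \<and> (\<forall>x\<in>carrier G. z \<otimes> x = x \<otimes> z)"
proof -
  have sylow: "\<exists>S. subgroup S G \<and> card S = q ^ multiplicity q (order G)" if "prime q" for q
    using sylow_thm[OF that is_group _ fin] multiplicity_dvd[of q "order G"] by (metis dvdE)
  have order: "order G \<noteq> 0" "order G \<noteq> 1"
    using fin nontriv order_one_triv_iff by (auto simp: order_def)
  obtain p where p: "prime p" "p dvd order G"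
    using order(2) prime_factor_nat by blast
  let ?a = "multiplicity p (order G)"
  have a: "?a > 0"
    using p order(1) by (simp add: prime_multiplicity_gt_zero_iff)
  obtain P where P: "subgroup P G" "card P = p ^ ?a"
    using sylow[OF p(1)] by blast
  interpret P: group "G\<lparr>carrier := P\<rparr>" using P(1) by (rule subgroup_imp_group)
  obtain z where z: "z \<in> P" "z \<noteq> \<one>" "\<And>x. x \<in> P \<Longrightarrow> z \<otimes> x = x \<otimes> z"
    using P.p_group_central_element[OF p(1) _ a] P(2) by (auto simp: order_def)
  have zG: "z \<in> carrier G" using z(1) P(1) subgroup.subset by blast
  let ?C = "{x \<in> carrier G. \<forall>s\<in>{z}. x \<otimes> s = s \<otimes> x}"
  have C: "subgroup ?C G" using zG by (intro centralizer_subgroup) simp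
  have big: "\<exists>S. subgroup S G \<and> S \<subseteq> ?C \<and> card S = q ^ multiplicity q (order G)" if q: "prime q" for q
  proof (cases "q = p")
    case True
    have "P \<subseteq> ?C" using z(3) subgroup.subset[OF P(1)] by (auto dest: subsetD)
    then show ?thesis using P True by blast
  next
    case False
    let ?b = "multiplicity q (order G)"
    obtain S where S: "subgroup S G" "card S = q ^ ?b" using sylow[OF q] by blast
    interpret S: group "G\<lparr>carrier := S\<rparr>" using S(1) by (rule subgroup_imp_group)
    have "s \<otimes> z = z \<otimes> s" if s: "s \<in> S" for s
    proof -
      have sG: "s \<in> carrier G" using s S(1) subgroup.subset by blast
      let ?K = "generate G {s, z}"
      have K: "subgroup ?K G" using sG zG by (intro generate_is_subgroup) auto
      interpret K: group "G\<lparr>carrier := ?K\<rparr>" using K by (rule subgroup_imp_group)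
      have "s [^] (q ^ ?b) = \<one>"
        using S.pow_order_eq_1[of s] s S(2) by (simp add: order_def flip: nat_pow_consistent)
      moreover have "z [^] (p ^ ?a) = \<one>"
        using P.pow_order_eq_1[of z] z(1) P(2) by (simp add: order_def flip: nat_pow_consistent)
      moreover have "coprime (q ^ ?b) (p ^ ?a)"
        using p(1) q False by (simp add: primes_coprime)
      moreover have "nilpotent (G\<lparr>carrier := ?K\<rparr>)"
        using pairs[OF sG zG] unfolding generates_nilpotent_def .
      ultimately show ?thesis
        using K.nilpotent_coprime_commute[of s z "q ^ ?b" "p ^ ?a"]
        by (simp add: generate.incl flip: nat_pow_consistent)
    qed
    then show ?thesis using S subgroup.subset[OF S(1)] by (intro exI[of _ S]) auto
  qed
  have dvd: "q ^ multiplicity q (order G) dvd card ?C" if q: "prime q" for q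
  proof -
    obtain S where S: "subgroup S G" "S \<subseteq> ?C" "card S = q ^ multiplicity q (order G)"
      using big[OF q] by (elim exE conjE)
    show ?thesis unfolding S(3)[symmetric] by (rule subgroup_card_dvd[OF S(1) C S(2)])
  qed
  have pos: "card ?C \<noteq> 0"
    using subgroup.finite_imp_card_positive[OF C fin] by (rule gr_implies_not0)
  have "order G dvd card ?C"
  proof (rule multiplicity_le_imp_dvd[OF order(1)])
    fix q :: nat assume q: "prime q"
    show "multiplicity q (order G) \<le> multiplicity q (card ?C)"
      using not_prime_unit q by (intro multiplicity_geI[OF pos _ dvd[OF q]]) blast
  qed
  then have "card (carrier G) \<le> card ?C"
    unfolding order_def using pos by (intro dvd_imp_le) blast+
  moreover have "?C \<subseteq> carrier G" by blast
  ultimately have eq: "?C = carrier G"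
    using fin by (intro card_seteq)
  have "\<forall>x\<in>carrier G. z \<otimes> x = x \<otimes> z"
  proof
    fix x assume "x \<in> carrier G"
    then have "x \<in> ?C" unfolding eq .
    then show "z \<otimes> x = x \<otimes> z" by simp
  qed
  then show ?thesis using z(2) zG by (intro bexI[of _ z] conjI)
qed

text \<open>
  By finiteness \<open>Z\<^sub>n\<^sub>+\<^sub>1 = Z\<^sub>n\<close> for some \<open>n\<close>, so \<open>G / Z\<^sub>n\<close> has trivial centre. Its two-generated subgroups are
  images of those of \<open>G\<close>, so by the preceding lemma the quotient is trivial.
\<close>

theorem (in group) nilpotent_if_all_pairs_nilpotent:
  assumes fin: "finite (carrier G)"
    and pairs: "\<And>x y. x \<in> carrier G \<Longrightarrow> y \<in> carrier G \<Longrightarrow> generates_nilpotent G x y"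
  shows "nilpotent G"
proof -
  have "\<exists>n. upper_central G (Suc n) = upper_central G n"
  proof (rule ccontr)
    assume "\<nexists>n. upper_central G (Suc n) = upper_central G n"
    then have strict: "upper_central G n \<subset> upper_central G (Suc n)" for n
      using upper_central_incr[of n] by (metis psubsetI)
    have fin_uc: "finite (upper_central G n)" for n
      using fin upper_central_subset by (rule rev_finite_subset)
    have "n \<le> card (upper_central G n)" for n
    proof (induction n)
      case (Suc n)
      then show ?case using psubset_card_mono[OF fin_uc strict, of n] by linarith
    qed simp
    moreover have "card (upper_central G n) \<le> card (carrier G)" for n
      by (rule card_mono[OF fin upper_central_subset])
    ultimately have "Suc (card (carrier G)) \<le> card (carrier G)" by (rule order_trans)
    then show False by simp
  qed
  then obtain n where n: "upper_central G (Suc n) = upper_central G n" by blast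
  let ?Z = "upper_central G n"
  interpret N: normal ?Z G by (rule upper_central_normal)
  interpret q: group_hom G "G Mod ?Z" "\<lambda>a. ?Z #> a" by (rule N.coset_map_group_hom)
  have Qpairs: "generates_nilpotent (G Mod ?Z) X Y"
    if "X \<in> carrier (G Mod ?Z)" "Y \<in> carrier (G Mod ?Z)" for X Y
    using that pairs q.generates_nilpotent_image unfolding carrier_FactGroup by blast
  have finQ: "finite (carrier (G Mod ?Z))" unfolding carrier_FactGroup using fin by simp
  have "carrier (G Mod ?Z) = {\<one>\<^bsub>G Mod ?Z\<^esub>}"
  proof (rule ccontr)
    assume "carrier (G Mod ?Z) \<noteq> {\<one>\<^bsub>G Mod ?Z\<^esub>}"
    then obtain W where W: "W \<in> carrier (G Mod ?Z)" "W \<noteq> \<one>\<^bsub>G Mod ?Z\<^esub>"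
      and central: "\<forall>Y\<in>carrier (G Mod ?Z). W \<otimes>\<^bsub>G Mod ?Z\<^esub> Y = Y \<otimes>\<^bsub>G Mod ?Z\<^esub> W"
      using q.H.central_element_if_all_pairs_nilpotent[OF finQ _ Qpairs] by blast
    obtain w where w: "w \<in> carrier G" "W = ?Z #> w"
      using W(1) unfolding carrier_FactGroup by blast
    have "w \<in> upper_central G (Suc n)"
      unfolding upper_central_Suc_iff[OF w(1)] using central unfolding w(2) .
    then show False
      using W(2) N.coset_eq_one_iff[OF w(1)] unfolding n w(2) by blast
  qed
  then have "x \<in> ?Z" if "x \<in> carrier G" for x
    using N.coset_eq_one_iff[OF that] q.hom_closed[OF that] by blast
  then show ?thesis
    unfolding nilpotent_def using upper_central_subset[of n] by (intro exI[of _ n]) blast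
qed

section \<open>The nilpotent graph of a direct product\<close>

lemma nil_DirProd_iff:
  assumes "group G" "group H" "g \<in> carrier G" "h \<in> carrier H"
  shows "(g, h) \<in> nil (G \<times>\<times> H) \<longleftrightarrow> g \<in> nil G \<and> h \<in> nil H"
proof -
  have "\<one>\<^bsub>G\<^esub> \<in> carrier G" "\<one>\<^bsub>H\<^esub> \<in> carrier H"
    using assms by (auto simp: group.is_monoid)
  then show ?thesis
    using assms by (auto simp: nil_def generates_nilpotent_DirProd)
qed

lemma (in group) non_nil_element_exists:
  assumes "finite (carrier G)" "\<not> nilpotent G"
  shows "\<exists>g\<in>carrier G. g \<notin> nil G"
  using assms nilpotent_if_all_pairs_nilpotent unfolding nil_def by blast

lemma nilpotent_graph_reachable_if_commute:
  assumes "group G" "finite (carrier G)"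
    and "u \<in> carrier G - nil G" "v \<in> carrier G - nil G" "u \<otimes>\<^bsub>G\<^esub> v = v \<otimes>\<^bsub>G\<^esub> u"
  shows "u \<rightarrow>\<^sup>*\<^bsub>with_proj (nilpotent_graph G)\<^esub> v"
proof -
  interpret pair_graph "nilpotent_graph G"
    using assms(2) by (rule pair_graph_nilpotent_graph)
  have "generates_nilpotent G u v"
    using assms by (intro group.generates_nilpotent_if_commute) auto
  then have "u = v \<or> (u, v) \<in> parcs (nilpotent_graph G)"
    using assms(3,4) by (auto simp: nilpotent_graph_def)
  moreover have "u \<in> pverts (nilpotent_graph G)"
    using assms(3) by (simp add: nilpotent_graph_def)
  ultimately show ?thesis by auto
qed

theorem proposition4p3:
  fixes G :: "('a, 'c) monoid_scheme" and H :: "('b, 'd) monoid_scheme"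
  assumes "group G" and "finite (carrier G)" and "\<not> nilpotent G"
    and "group H" and "finite (carrier H)" and "\<not> nilpotent H"
  shows "Digraph_Component.connected (with_proj (nilpotent_graph (G \<times>\<times> H)))"
proof -
  interpret G: group G by fact
  interpret H: group H by fact
  let ?P = "G \<times>\<times> H"
  let ?V = "carrier ?P - nil ?P"
  have P: "group ?P" by (rule DirProd_group[OF assms(1,4)])
  have fin: "finite (carrier ?P)" using assms by simp
  interpret graph: pair_graph "nilpotent_graph ?P"
    using fin by (rule pair_graph_nilpotent_graph)
  note nil_iff = nil_DirProd_iff[OF assms(1,4)]
  let ?reach = "\<lambda>u v. u \<rightarrow>\<^sup>*\<^bsub>with_proj (nilpotent_graph ?P)\<^esub> v"
  have step: "?reach u v" if "u \<in> ?V" "v \<in> ?V" "u \<otimes>\<^bsub>?P\<^esub> v = v \<otimes>\<^bsub>?P\<^esub> u" for u v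
    using nilpotent_graph_reachable_if_commute[OF P fin that] .
  obtain g0 where g0: "g0 \<in> carrier G" "g0 \<notin> nil G"
    using G.non_nil_element_exists assms(2,3) by blast
  obtain h0 where h0: "h0 \<in> carrier H" "h0 \<notin> nil H"
    using H.non_nil_element_exists assms(5,6) by blast
  \<comment> \<open>Reachability is symmetric, so it suffices to connect every vertex to one fixed vertex.\<close>
  let ?hub = "(g0, \<one>\<^bsub>H\<^esub>)"
  have left: "?reach (g, \<one>\<^bsub>H\<^esub>) (\<one>\<^bsub>G\<^esub>, h)"
    if "g \<in> carrier G" "g \<notin> nil G" "h \<in> carrier H" "h \<notin> nil H" for g h
    using that by (intro step) (simp_all add: nil_iff)
  have right: "?reach (\<one>\<^bsub>G\<^esub>, h) (g, \<one>\<^bsub>H\<^esub>)"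
    if "g \<in> carrier G" "g \<notin> nil G" "h \<in> carrier H" "h \<notin> nil H" for g h
    using that by (intro step) (simp_all add: nil_iff)
  have to_hub: "?reach u ?hub" if u: "u \<in> ?V" for u
  proof -
    obtain g h where [simp]: "u = (g, h)" by (cases u)
    have c: "g \<in> carrier G" "h \<in> carrier H" and cases: "g \<notin> nil G \<or> h \<notin> nil H"
      using u nil_iff by auto
    from cases show ?thesis
    proof
      assume g: "g \<notin> nil G"
      have "?reach u (g, \<one>\<^bsub>H\<^esub>)" using u c g by (intro step) (simp_all add: nil_iff)
      also have "?reach \<dots> (\<one>\<^bsub>G\<^esub>, h0)" by (rule left) fact+
      also have "?reach \<dots> ?hub" by (rule right) fact+
      finally show ?thesis .
    next
      assume h: "h \<notin> nil H"
      have "?reach u (\<one>\<^bsub>G\<^esub>, h)" using u c h by (intro step) (simp_all add: nil_iff)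
      also have "?reach \<dots> ?hub" by (rule right) fact+
      finally show ?thesis .
    qed
  qed
  show ?thesis
  proof (rule graph.connectedI)
    show "pverts (nilpotent_graph ?P) \<noteq> {}"
      using g0 nil_iff[of g0 "\<one>\<^bsub>H\<^esub>"] by (auto simp: nilpotent_graph_def)
  next
    fix u v assume "u \<in> pverts (nilpotent_graph ?P)" "v \<in> pverts (nilpotent_graph ?P)"
    then have "?reach u ?hub" "?reach v ?hub"
      using to_hub by (auto simp: nilpotent_graph_def)
    then have "?reach u v"
      using graph.reachable_trans symmetric_reachable[OF graph.sym_arcs] by blast
    then show "u \<rightarrow>\<^sup>*\<^bsub>with_proj (mk_symmetric (with_proj (nilpotent_graph ?P)))\<^esub> v"
      by (rule graph.reachable_mk_symmetricI)
  qed
qed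

end
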